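(* The operators $$F^\lambda=\sum_{m=0}^\infty\frac{(-t)^m}{m!\prod_{j=0}^{m-1}(\lambda-jt)}(\boldsymbol x\otimes\boldsymbol y)^m$$ and $$\mathrm{id}\otimes\mathrm{id}+\sum_{r=1}^\infty\Bigl(-\frac t{2\mu}\Bigr)^r\sum_{s=1}^r\sum_{k=1}^s\frac{(-1)^{r-k}k^{r-1}}{s!\,(s-k)!\,(k-1)!}(\boldsymbol x\otimes\boldsymbol y)^s$$ coincide upon the identification $2\mu-t=\lambda$.
   Context: Here $t$ is a formal parameter, $\mu$ is an invertible parameter (e.g. a non-zero complex number), both expressions are regarded as formal power series in $t$ (after substituting $\lambda=2\mu-t$), and $\boldsymbol x\otimes\boldsymbol y=\sum_{i=1}^nx_i\otimes y_i$ is the invariant element of $\mathfrak n^+\otimes\mathfrak n^-$, where $x_i=E_{1,i+1}$, $y_i=E_{i+1,1}$ are the root vectors spanning the abelian nil-radicals $\mathfrak n^\pm$ of the parabolic subalgebras of $\mathfrak{gl}(n+1)$ with Levi subalgebra $\mathfrak{gl}(1)\oplus\mathfrak{gl}(n)$; the powers are taken in $U(\mathfrak n^+)\otimes U(\mathfrak n^-)$ and act as bidifferential operators on pairs of functions on $GL(n+1)/GL(n)\times GL(1)$. The first operator is the (scalar reduced) dynamical twist defining the $\mathfrak{gl}(n+1)$-invariant star product on $GL(n+1)/GL(n)\times GL(1)$; the second is the bidifferential operator of the star product of Bordemann–Brischle–Emmrich–Waldmann on the (complexified) projective space. *)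

theory Defs
  imports "HOL-Analysis.Analysis" "HOL-Library.Poly_Mapping"
begin

section \<open>Quotients of associative algebras\<close>

inductive_set ideal_generated :: "'a::ring_1 set \<Rightarrow> 'a set" for R where
  zero: "0 \<in> ideal_generated R"
| gen: "r \<in> R \<Longrightarrow> a * r * b \<in> ideal_generated R"
| add: "p \<in> ideal_generated R \<Longrightarrow> q \<in> ideal_generated R \<Longrightarrow> p + q \<in> ideal_generated R"

lemma ideal_generated_mult_left:
  "p \<in> ideal_generated R \<Longrightarrow> c * p \<in> ideal_generated R"
proof (induction rule: ideal_generated.induct)
  case (gen r a b)
  then show ?case
    using ideal_generated.gen[of r R "c * a" b] by (simp add: mult.assoc)
qed (auto simp: distrib_left intro: ideal_generated.intros)

lemma ideal_generated_mult_right: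
  "p \<in> ideal_generated R \<Longrightarrow> p * c \<in> ideal_generated R"
proof (induction rule: ideal_generated.induct)
  case (gen r a b)
  then show ?case
    using ideal_generated.gen[of r R a "b * c"] by (simp add: mult.assoc)
qed (auto simp: distrib_right intro: ideal_generated.intros)

lemma ideal_generated_uminus:
  "p \<in> ideal_generated R \<Longrightarrow> - p \<in> ideal_generated R"
  using ideal_generated_mult_left[of p R "- 1"] by simp

definition ideal_cong :: "'a::ring_1 set \<Rightarrow> 'a \<Rightarrow> 'a \<Rightarrow> bool" where
  "ideal_cong R p q \<longleftrightarrow> p - q \<in> ideal_generated R"

lemma equivp_ideal_cong: "equivp (ideal_cong R)"
proof (rule equivpI)
  show "reflp (ideal_cong R)"
    by (auto simp: reflp_def ideal_cong_def intro: ideal_generated.zero)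
  show "symp (ideal_cong R)"
    by (metis ideal_cong_def ideal_generated_uminus minus_diff_eq sympI)
  show "transp (ideal_cong R)"
  proof (rule transpI)
    fix p q r
    assume "ideal_cong R p q" "ideal_cong R q r"
    then have "(p - q) + (q - r) \<in> ideal_generated R"
      unfolding ideal_cong_def by (rule ideal_generated.add)
    then show "ideal_cong R p r" by (simp add: ideal_cong_def)
  qed
qed

lemma ideal_cong_add:
  "ideal_cong R p p' \<Longrightarrow> ideal_cong R q q' \<Longrightarrow> ideal_cong R (p + q) (p' + q')"
  unfolding ideal_cong_def
  by (drule (1) ideal_generated.add) (simp add: algebra_simps)

lemma ideal_cong_uminus: "ideal_cong R p p' \<Longrightarrow> ideal_cong R (- p) (- p')"
  unfolding ideal_cong_def by (drule ideal_generated_uminus) simp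

lemma ideal_cong_diff:
  "ideal_cong R p p' \<Longrightarrow> ideal_cong R q q' \<Longrightarrow> ideal_cong R (p - q) (p' - q')"
  using ideal_cong_add[OF _ ideal_cong_uminus, of R p p' q q'] by simp

lemma ideal_cong_mult:
  assumes "ideal_cong R p p'" "ideal_cong R q q'"
  shows "ideal_cong R (p * q) (p' * q')"
proof -
  have "p * q - p' * q' = (p - p') * q + p' * (q - q')"
    by (simp add: algebra_simps)
  then show ?thesis
    using assms unfolding ideal_cong_def
    by (simp add: ideal_generated.add ideal_generated_mult_left ideal_generated_mult_right)
qed

section \<open>Monoid algebras\<close>

text \<open>
  For an additively written monoid \<open>'w\<close> the library's convolution product makes
  \<open>'w \<Rightarrow>\<^sub>0 'k\<close> the monoid algebra.
  \<open>algebra_extension \<phi>\<close> is the linear extension of \<open>\<phi>\<close>; it is only used to see that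
  the quotients below are non-trivial.
\<close>

definition algebra_extension :: "('w \<Rightarrow> 'k) \<Rightarrow> ('w \<Rightarrow>\<^sub>0 'k::field) \<Rightarrow> 'k" where
  "algebra_extension \<phi> p = (\<Sum>w\<in>Poly_Mapping.keys p. Poly_Mapping.lookup p w * \<phi> w)"

lemma algebra_extension_superset:
  assumes "finite S" "Poly_Mapping.keys p \<subseteq> S"
  shows "algebra_extension \<phi> p = (\<Sum>w\<in>S. Poly_Mapping.lookup p w * \<phi> w)"
  unfolding algebra_extension_def using assms
  by (intro sum.mono_neutral_left) (auto simp: in_keys_iff)

lemma algebra_extension_add:
  "algebra_extension \<phi> (p + q) = algebra_extension \<phi> p + algebra_extension \<phi> q"
proof -
  let ?S = "Poly_Mapping.keys p \<union> Poly_Mapping.keys q"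
  have "Poly_Mapping.keys (p + q) \<subseteq> ?S" by (rule Poly_Mapping.keys_add)
  then show ?thesis
    by (simp add: algebra_extension_superset[of ?S] lookup_add distrib_right sum.distrib)
qed

lemma algebra_extension_zero [simp]: "algebra_extension \<phi> 0 = 0"
  by (simp add: algebra_extension_def)

lemma algebra_extension_single [simp]:
  "algebra_extension \<phi> (Poly_Mapping.single w c) = c * \<phi> w"
  by (simp add: algebra_extension_def)

lemma algebra_extension_uminus: "algebra_extension \<phi> (- p) = - algebra_extension \<phi> p"
  using algebra_extension_add[of \<phi> p "- p"] by (simp add: eq_neg_iff_add_eq_0 add.commute)

lemma algebra_extension_diff:
  "algebra_extension \<phi> (p - q) = algebra_extension \<phi> p - algebra_extension \<phi> q"
  using algebra_extension_add[of \<phi> p "- q"] by (simp add: algebra_extension_uminus)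

lemma poly_mapping_single_add_induct [case_names single zero add]:
  assumes "\<And>w c. P (Poly_Mapping.single w c)" "P 0" "\<And>p q. P p \<Longrightarrow> P q \<Longrightarrow> P (p + q)"
  shows "P (p :: 'w \<Rightarrow>\<^sub>0 'k::comm_monoid_add)"
proof (induction p rule: update_induct)
  case const
  show ?case by (rule assms(2))
next
  case (update f a b)
  have "Poly_Mapping.update a b f = f + Poly_Mapping.single a b"
    using update(1)
    by (intro poly_mapping_eqI) (auto simp: lookup_update lookup_add lookup_single in_keys_iff)
  then show ?case using update(3) assms by simp
qed

lemma algebra_extension_mult:
  assumes hom: "\<And>u v. \<phi> (u + v) = \<phi> u * \<phi> v"
  shows "algebra_extension \<phi> (p * q) = algebra_extension \<phi> p * algebra_extension \<phi> q"
proof (induction p rule: poly_mapping_single_add_induct)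
  case (single u c)
  show ?case
    by (induction q rule: poly_mapping_single_add_induct)
      (simp_all add: mult_single hom distrib_left algebra_extension_add)
qed (simp_all add: distrib_right algebra_extension_add)

lemma algebra_extension_ideal:
  assumes "\<And>u v. \<phi> (u + v) = \<phi> u * \<phi> v" and "\<And>r. r \<in> R \<Longrightarrow> algebra_extension \<phi> r = 0"
    and "p \<in> ideal_generated R"
  shows "algebra_extension \<phi> p = 0"
  using assms(3)
  by induction (simp_all add: algebra_extension_mult assms(1,2) algebra_extension_add)

section \<open>Universal enveloping algebras of Lie algebras of matrices\<close>

datatype 'v word = Word (letters: "'v list")

instantiation word :: (type) monoid_add
begin
definition "0 = Word []"
definition "u + v = Word (letters u @ letters v)"
instance by standard (simp_all add: zero_word_def plus_word_def)
end

text \<open>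
  \<open>'v word \<Rightarrow>\<^sub>0 'k\<close> is the free associative algebra on the set \<open>'v\<close>. When \<open>rep\<close> is
  injective and its image is a Lie subalgebra of matrices, the quotient by
  the following elements is the universal enveloping algebra of that Lie algebra: the first two
  families turn the free algebra into the tensor algebra of the vector space, the third one
  is \<open>X \<otimes> Y - Y \<otimes> X - [X, Y]\<close>.
\<close>

definition uea_relators :: "('v \<Rightarrow> 'k::field^'m^'m) \<Rightarrow> ('v word \<Rightarrow>\<^sub>0 'k) set" where
  "uea_relators rep =
     {Poly_Mapping.single (Word [Z]) 1 - Poly_Mapping.single (Word [X]) 1
        - Poly_Mapping.single (Word [Y]) 1 | X Y Z. rep Z = rep X + rep Y}
   \<union> {Poly_Mapping.single (Word [Z]) 1 - Poly_Mapping.single (Word [X]) c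
        | c X Z. rep Z = map_matrix ((*) c) (rep X)}
   \<union> {Poly_Mapping.single (Word [X, Y]) 1 - Poly_Mapping.single (Word [Y, X]) 1
        - Poly_Mapping.single (Word [Z]) 1 | X Y Z. rep Z = rep X ** rep Y - rep Y ** rep X}"

definition word_counit :: "'v word \<Rightarrow> 'k::field" where
  "word_counit w = (if w = 0 then 1 else 0)"

lemma word_counit_add: "word_counit (u + v) = word_counit u * word_counit v"
  by (cases u; cases v) (auto simp: word_counit_def zero_word_def plus_word_def)

lemma word_counit_zero [simp]: "word_counit 0 = 1"
  by (simp add: word_counit_def)

lemma algebra_extension_uea_relators:
  "p \<in> ideal_generated (uea_relators rep) \<Longrightarrow> algebra_extension word_counit p = 0"
  by (rule algebra_extension_ideal[OF word_counit_add])
    (auto simp: uea_relators_def algebra_extension_diff word_counit_def zero_word_def)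

lemma algebra_extension_uea_cong:
  "ideal_cong (uea_relators rep) p q \<Longrightarrow>
     algebra_extension word_counit p = algebra_extension word_counit q"
  unfolding ideal_cong_def
  by (drule algebra_extension_uea_relators) (simp add: algebra_extension_diff)

section \<open>The nil-radicals and their enveloping algebras\<close>

text \<open>
  Rows and columns of elements of \<open>gl(n+1)\<close> are indexed by \<open>'n option\<close>: \<open>None\<close> stands for the
  index \<open>1\<close> and \<open>Some i\<close> for the index \<open>i + 1\<close>, where \<open>i\<close> runs through \<open>'n\<close> and
  \<open>n = CARD('n)\<close>.
\<close>

type_synonym ('k, 'n) mat1 = "'k^('n option)^('n option)"

definition matrix_unit :: "'m \<Rightarrow> 'm \<Rightarrow> 'k::zero_neq_one^'m^'m" where
  "matrix_unit a b = (\<chi> i j. if i = a \<and> j = b then 1 else 0)"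

definition x_mat :: "'n::finite \<Rightarrow> ('k::field, 'n) mat1" where
  "x_mat i = matrix_unit None (Some i)"

definition y_mat :: "'n::finite \<Rightarrow> ('k::field, 'n) mat1" where
  "y_mat i = matrix_unit (Some i) None"

typedef (overloaded) ('k, 'n) nil_plus =
  "{A :: ('k::field, 'n::finite) mat1.
      \<exists>c. A = (\<Sum>i\<in>UNIV. map_matrix ((*) (c i)) (x_mat i))}"
  by blast

typedef (overloaded) ('k, 'n) nil_minus =
  "{A :: ('k::field, 'n::finite) mat1.
      \<exists>c. A = (\<Sum>i\<in>UNIV. map_matrix ((*) (c i)) (y_mat i))}"
  by blast

lemma map_matrix_component: "map_matrix f A $ i $ j = f (A $ i $ j)"
  by (simp add: map_matrix_def)

lemma nil_plus_iff:
  fixes A :: "('k::field, 'n::finite) mat1"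
  shows "(\<exists>c. A = (\<Sum>i\<in>UNIV. map_matrix ((*) (c i)) (x_mat i))) \<longleftrightarrow> (\<forall>a b. A $ a $ b \<noteq> 0 \<longrightarrow> a = None \<and> b \<noteq> None)"
proof -
  have *: "(\<Sum>i\<in>UNIV. map_matrix ((*) (c i)) (x_mat i :: ('k, 'n) mat1)) $ a $ b =
      (case (a, b) of (None, Some i) \<Rightarrow> c i | _ \<Rightarrow> 0)" for c :: "'n \<Rightarrow> 'k" and a b
    by (auto simp: sum_component map_matrix_component x_mat_def matrix_unit_def
        if_distrib[of "(*) _"] sum.delta split: option.splits cong: if_cong)
  show ?thesis
  proof
    assume "\<exists>c. A = (\<Sum>i\<in>UNIV. map_matrix ((*) (c i)) (x_mat i))"
    then obtain c where "A = (\<Sum>i\<in>UNIV. map_matrix ((*) (c i)) (x_mat i))" by blast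
    then show "\<forall>a b. A $ a $ b \<noteq> 0 \<longrightarrow> a = None \<and> b \<noteq> None"
      by (simp only: *) (auto split: option.splits)
  next
    assume A: "\<forall>a b. A $ a $ b \<noteq> 0 \<longrightarrow> a = None \<and> b \<noteq> None"
    have "A = (\<Sum>i\<in>UNIV. map_matrix ((*) (A $ None $ Some i)) (x_mat i))"
      unfolding vec_eq_iff * using A by (auto split: option.splits)
    then show "\<exists>c. A = (\<Sum>i\<in>UNIV. map_matrix ((*) (c i)) (x_mat i))"
      by (rule exI[of _ "\<lambda>i. A $ None $ Some i"])
  qed
qed

lemma nil_plus_Lie_subalgebra:
  fixes X Y :: "('k::field, 'n::finite) nil_plus"
  shows "\<exists>Z. Rep_nil_plus Z = Rep_nil_plus X + Rep_nil_plus Y"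
    and "\<exists>Z. Rep_nil_plus Z = map_matrix ((*) c) (Rep_nil_plus X)"
    and "\<exists>Z. Rep_nil_plus Z = Rep_nil_plus X ** Rep_nil_plus Y - Rep_nil_plus Y ** Rep_nil_plus X"
proof -
  let ?C = "\<lambda>A :: ('k, 'n) mat1. \<forall>a b. A $ a $ b \<noteq> 0 \<longrightarrow> a = None \<and> b \<noteq> None"
  have ex: "\<exists>Z. Rep_nil_plus Z = A" if "?C A" for A :: "('k, 'n) mat1"
    using that Abs_nil_plus_inverse[of A] by (auto simp: nil_plus_iff)
  have C: "?C (Rep_nil_plus W)" for W :: "('k, 'n) nil_plus"
    using Rep_nil_plus[of W] by (simp only: mem_Collect_eq nil_plus_iff)
  show "\<exists>Z. Rep_nil_plus Z = Rep_nil_plus X + Rep_nil_plus Y"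
    by (rule ex) (metis C add_0 vector_add_component)
  show "\<exists>Z. Rep_nil_plus Z = map_matrix ((*) c) (Rep_nil_plus X)"
    by (rule ex) (metis C map_matrix_component mult_zero_right)
  have "Rep_nil_plus V $ a $ b * Rep_nil_plus W $ b $ d = 0" for V W :: "('k, 'n) nil_plus" and a b d
    using C[of V] C[of W] by (metis mult_eq_0_iff)
  then have "Rep_nil_plus V ** Rep_nil_plus W = 0" for V W :: "('k, 'n) nil_plus"
    by (auto simp: matrix_matrix_mult_def vec_eq_iff intro!: sum.neutral)
  then show "\<exists>Z. Rep_nil_plus Z = Rep_nil_plus X ** Rep_nil_plus Y - Rep_nil_plus Y ** Rep_nil_plus X"
    by (intro ex) simp
qed

lemma nil_minus_iff:
  fixes A :: "('k::field, 'n::finite) mat1"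
  shows "(\<exists>c. A = (\<Sum>i\<in>UNIV. map_matrix ((*) (c i)) (y_mat i))) \<longleftrightarrow> (\<forall>a b. A $ a $ b \<noteq> 0 \<longrightarrow> a \<noteq> None \<and> b = None)"
proof -
  have *: "(\<Sum>i\<in>UNIV. map_matrix ((*) (c i)) (y_mat i :: ('k, 'n) mat1)) $ a $ b =
      (case (b, a) of (None, Some i) \<Rightarrow> c i | _ \<Rightarrow> 0)" for c :: "'n \<Rightarrow> 'k" and a b
    by (auto simp: sum_component map_matrix_component y_mat_def matrix_unit_def
        if_distrib[of "(*) _"] sum.delta split: option.splits cong: if_cong)
  show ?thesis
  proof
    assume "\<exists>c. A = (\<Sum>i\<in>UNIV. map_matrix ((*) (c i)) (y_mat i))"
    then obtain c where "A = (\<Sum>i\<in>UNIV. map_matrix ((*) (c i)) (y_mat i))" by blast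
    then show "\<forall>a b. A $ a $ b \<noteq> 0 \<longrightarrow> a \<noteq> None \<and> b = None"
      by (simp only: *) (auto split: option.splits)
  next
    assume A: "\<forall>a b. A $ a $ b \<noteq> 0 \<longrightarrow> a \<noteq> None \<and> b = None"
    have "A = (\<Sum>i\<in>UNIV. map_matrix ((*) (A $ Some i $ None)) (y_mat i))"
      unfolding vec_eq_iff * using A by (auto split: option.splits)
    then show "\<exists>c. A = (\<Sum>i\<in>UNIV. map_matrix ((*) (c i)) (y_mat i))"
      by (rule exI[of _ "\<lambda>i. A $ Some i $ None"])
  qed
qed

lemma nil_minus_Lie_subalgebra:
  fixes X Y :: "('k::field, 'n::finite) nil_minus"
  shows "\<exists>Z. Rep_nil_minus Z = Rep_nil_minus X + Rep_nil_minus Y"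
    and "\<exists>Z. Rep_nil_minus Z = map_matrix ((*) c) (Rep_nil_minus X)"
    and "\<exists>Z. Rep_nil_minus Z = Rep_nil_minus X ** Rep_nil_minus Y - Rep_nil_minus Y ** Rep_nil_minus X"
proof -
  let ?C = "\<lambda>A :: ('k, 'n) mat1. \<forall>a b. A $ a $ b \<noteq> 0 \<longrightarrow> a \<noteq> None \<and> b = None"
  have ex: "\<exists>Z. Rep_nil_minus Z = A" if "?C A" for A :: "('k, 'n) mat1"
    using that Abs_nil_minus_inverse[of A] by (auto simp: nil_minus_iff)
  have C: "?C (Rep_nil_minus W)" for W :: "('k, 'n) nil_minus"
    using Rep_nil_minus[of W] by (simp only: mem_Collect_eq nil_minus_iff)
  show "\<exists>Z. Rep_nil_minus Z = Rep_nil_minus X + Rep_nil_minus Y"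
    by (rule ex) (metis C add_0 vector_add_component)
  show "\<exists>Z. Rep_nil_minus Z = map_matrix ((*) c) (Rep_nil_minus X)"
    by (rule ex) (metis C map_matrix_component mult_zero_right)
  have "Rep_nil_minus V $ a $ b * Rep_nil_minus W $ b $ d = 0" for V W :: "('k, 'n) nil_minus" and a b d
    using C[of V] C[of W] by (metis mult_eq_0_iff)
  then have "Rep_nil_minus V ** Rep_nil_minus W = 0" for V W :: "('k, 'n) nil_minus"
    by (auto simp: matrix_matrix_mult_def vec_eq_iff intro!: sum.neutral)
  then show "\<exists>Z. Rep_nil_minus Z = Rep_nil_minus X ** Rep_nil_minus Y - Rep_nil_minus Y ** Rep_nil_minus X"
    by (intro ex) simp
qed

quotient_type (overloaded) ('k, 'n) U_plus =
  "('k::field, 'n::finite) nil_plus word \<Rightarrow>\<^sub>0 'k" / "ideal_cong (uea_relators Rep_nil_plus)"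
  by (rule equivp_ideal_cong)

instantiation U_plus :: (field, finite) ring_1
begin
lift_definition zero_U_plus :: "('a, 'b) U_plus" is 0 .
lift_definition one_U_plus :: "('a, 'b) U_plus" is 1 .
lift_definition plus_U_plus :: "('a, 'b) U_plus \<Rightarrow> ('a, 'b) U_plus \<Rightarrow> ('a, 'b) U_plus" is "(+)"
  by (rule ideal_cong_add)
lift_definition minus_U_plus :: "('a, 'b) U_plus \<Rightarrow> ('a, 'b) U_plus \<Rightarrow> ('a, 'b) U_plus" is "(-)"
  by (rule ideal_cong_diff)
lift_definition uminus_U_plus :: "('a, 'b) U_plus \<Rightarrow> ('a, 'b) U_plus" is "uminus"
  by (rule ideal_cong_uminus)
lift_definition times_U_plus :: "('a, 'b) U_plus \<Rightarrow> ('a, 'b) U_plus \<Rightarrow> ('a, 'b) U_plus" is "(*)"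
  by (rule ideal_cong_mult)
instance
proof
  fix a b c :: "('a, 'b) U_plus"
  note refl = equivp_reflp[OF equivp_ideal_cong]
  show "a + b + c = a + (b + c)" by transfer (simp add: add.assoc refl)
  show "a + b = b + a" by transfer (simp add: add.commute refl)
  show "0 + a = a" by transfer (simp add: refl)
  show "- a + a = 0" by transfer (simp add: refl)
  show "a - b = a + - b" by transfer (simp add: refl)
  show "a * b * c = a * (b * c)" by transfer (simp add: mult.assoc refl)
  show "(a + b) * c = a * c + b * c" by transfer (simp add: distrib_right refl)
  show "a * (b + c) = a * b + a * c" by transfer (simp add: distrib_left refl)
  show "1 * a = a" by transfer (simp add: refl)
  show "a * 1 = a" by transfer (simp add: refl)
  show "(0::('a, 'b) U_plus) \<noteq> 1"
    by transfer (auto dest: algebra_extension_uea_cong simp flip: single_one)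
qed
end

lift_definition U_plus_incl :: "('k::field, 'n::finite) nil_plus \<Rightarrow> ('k, 'n) U_plus"
  is "\<lambda>X. Poly_Mapping.single (Word [X]) 1" .

lift_definition U_plus_scalar :: "'k::field \<Rightarrow> ('k, 'n::finite) U_plus"
  is "Poly_Mapping.single 0" .

lift_definition U_plus_counit :: "('k::field, 'n::finite) U_plus \<Rightarrow> 'k"
  is "algebra_extension word_counit"
  by (rule algebra_extension_uea_cong)

lemma U_plus_counit_simps [simp]:
  fixes a b :: "('k::field, 'n::finite) U_plus"
  shows "U_plus_counit (a + b) = U_plus_counit a + U_plus_counit b"
    and "U_plus_counit (a * b) = U_plus_counit a * U_plus_counit b"
    and "U_plus_counit (1 :: ('k, 'n) U_plus) = 1"
    and "U_plus_counit (U_plus_scalar c :: ('k, 'n) U_plus) = c"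
  by (transfer, simp add: algebra_extension_add algebra_extension_mult[OF word_counit_add]
      flip: single_one)+

quotient_type (overloaded) ('k, 'n) U_minus =
  "('k::field, 'n::finite) nil_minus word \<Rightarrow>\<^sub>0 'k" / "ideal_cong (uea_relators Rep_nil_minus)"
  by (rule equivp_ideal_cong)

instantiation U_minus :: (field, finite) ring_1
begin
lift_definition zero_U_minus :: "('a, 'b) U_minus" is 0 .
lift_definition one_U_minus :: "('a, 'b) U_minus" is 1 .
lift_definition plus_U_minus :: "('a, 'b) U_minus \<Rightarrow> ('a, 'b) U_minus \<Rightarrow> ('a, 'b) U_minus" is "(+)"
  by (rule ideal_cong_add)
lift_definition minus_U_minus :: "('a, 'b) U_minus \<Rightarrow> ('a, 'b) U_minus \<Rightarrow> ('a, 'b) U_minus" is "(-)"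
  by (rule ideal_cong_diff)
lift_definition uminus_U_minus :: "('a, 'b) U_minus \<Rightarrow> ('a, 'b) U_minus" is "uminus"
  by (rule ideal_cong_uminus)
lift_definition times_U_minus :: "('a, 'b) U_minus \<Rightarrow> ('a, 'b) U_minus \<Rightarrow> ('a, 'b) U_minus" is "(*)"
  by (rule ideal_cong_mult)
instance
proof
  fix a b c :: "('a, 'b) U_minus"
  note refl = equivp_reflp[OF equivp_ideal_cong]
  show "a + b + c = a + (b + c)" by transfer (simp add: add.assoc refl)
  show "a + b = b + a" by transfer (simp add: add.commute refl)
  show "0 + a = a" by transfer (simp add: refl)
  show "- a + a = 0" by transfer (simp add: refl)
  show "a - b = a + - b" by transfer (simp add: refl)
  show "a * b * c = a * (b * c)" by transfer (simp add: mult.assoc refl)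
  show "(a + b) * c = a * c + b * c" by transfer (simp add: distrib_right refl)
  show "a * (b + c) = a * b + a * c" by transfer (simp add: distrib_left refl)
  show "1 * a = a" by transfer (simp add: refl)
  show "a * 1 = a" by transfer (simp add: refl)
  show "(0::('a, 'b) U_minus) \<noteq> 1"
    by transfer (auto dest: algebra_extension_uea_cong simp flip: single_one)
qed
end

lift_definition U_minus_incl :: "('k::field, 'n::finite) nil_minus \<Rightarrow> ('k, 'n) U_minus"
  is "\<lambda>X. Poly_Mapping.single (Word [X]) 1" .

lift_definition U_minus_scalar :: "'k::field \<Rightarrow> ('k, 'n::finite) U_minus"
  is "Poly_Mapping.single 0" .

lift_definition U_minus_counit :: "('k::field, 'n::finite) U_minus \<Rightarrow> 'k"
  is "algebra_extension word_counit"
  by (rule algebra_extension_uea_cong)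

lemma U_minus_counit_simps [simp]:
  fixes a b :: "('k::field, 'n::finite) U_minus"
  shows "U_minus_counit (a + b) = U_minus_counit a + U_minus_counit b"
    and "U_minus_counit (a * b) = U_minus_counit a * U_minus_counit b"
    and "U_minus_counit (1 :: ('k, 'n) U_minus) = 1"
    and "U_minus_counit (U_minus_scalar c :: ('k, 'n) U_minus) = c"
  by (transfer, simp add: algebra_extension_add algebra_extension_mult[OF word_counit_add]
      flip: single_one)+

section \<open>The algebra \<open>U(n\<^sup>+) \<otimes> U(n\<^sup>-)\<close>\<close>

text \<open>
  Symbols \<open>a \<otimes> b\<close>, multiplied componentwise. The tensor product of algebras is the algebra
  of formal linear combinations of such symbols modulo bilinearity.
\<close>

datatype ('a, 'b) pure_tensor = Pure_Tensor 'a 'b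

instantiation pure_tensor :: (monoid_mult, monoid_mult) monoid_add
begin
definition "0 = Pure_Tensor 1 1"
definition "p + q =
  (case (p, q) of (Pure_Tensor a b, Pure_Tensor a' b') \<Rightarrow> Pure_Tensor (a * a') (b * b'))"
instance
  by standard (auto simp: zero_pure_tensor_def plus_pure_tensor_def mult.assoc
      split: pure_tensor.splits)
end

definition tensor_relators :: 
    "((('k::field, 'n::finite) U_plus, ('k, 'n) U_minus) pure_tensor \<Rightarrow>\<^sub>0 'k) set" where
  "tensor_relators =
     {Poly_Mapping.single (Pure_Tensor (a + a') b) 1 - Poly_Mapping.single (Pure_Tensor a b) 1
        - Poly_Mapping.single (Pure_Tensor a' b) 1 | a a' b. True}
   \<union> {Poly_Mapping.single (Pure_Tensor a (b + b')) 1 - Poly_Mapping.single (Pure_Tensor a b) 1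
        - Poly_Mapping.single (Pure_Tensor a b') 1 | a b b'. True}
   \<union> {Poly_Mapping.single (Pure_Tensor (U_plus_scalar c * a) b) 1
        - Poly_Mapping.single (Pure_Tensor a b) c | a b c. True}
   \<union> {Poly_Mapping.single (Pure_Tensor a (U_minus_scalar c * b)) 1
        - Poly_Mapping.single (Pure_Tensor a b) c | a b c. True}"

definition tensor_counit :: 
    "(('k::field, 'n::finite) U_plus, ('k, 'n) U_minus) pure_tensor \<Rightarrow> 'k" where
  "tensor_counit p = (case p of Pure_Tensor a b \<Rightarrow> U_plus_counit a * U_minus_counit b)"

lemma tensor_counit_add: "tensor_counit (p + q) = tensor_counit p * tensor_counit q"
  by (cases p; cases q) (simp add: tensor_counit_def plus_pure_tensor_def)

lemma tensor_counit_zero [simp]: "tensor_counit 0 = 1"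
  by (simp add: tensor_counit_def zero_pure_tensor_def)

lemma algebra_extension_tensor_cong:
  assumes "ideal_cong tensor_relators p q"
  shows "algebra_extension tensor_counit p = algebra_extension tensor_counit q"
proof -
  have "algebra_extension tensor_counit (p - q) = 0"
    by (rule algebra_extension_ideal[OF tensor_counit_add _ assms[unfolded ideal_cong_def]])
      (auto simp: tensor_relators_def algebra_extension_diff tensor_counit_def
        distrib_left distrib_right mult.assoc mult.left_commute)
  then show ?thesis by (simp add: algebra_extension_diff)
qed

quotient_type (overloaded) ('k, 'n) U_tensor =
  "(('k::field, 'n::finite) U_plus, ('k, 'n) U_minus) pure_tensor \<Rightarrow>\<^sub>0 'k" / "ideal_cong tensor_relators"
  by (rule equivp_ideal_cong)

instantiation U_tensor :: (field, finite) ring_1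
begin
lift_definition zero_U_tensor :: "('a, 'b) U_tensor" is 0 .
lift_definition one_U_tensor :: "('a, 'b) U_tensor" is 1 .
lift_definition plus_U_tensor :: "('a, 'b) U_tensor \<Rightarrow> ('a, 'b) U_tensor \<Rightarrow> ('a, 'b) U_tensor" is "(+)"
  by (rule ideal_cong_add)
lift_definition minus_U_tensor :: "('a, 'b) U_tensor \<Rightarrow> ('a, 'b) U_tensor \<Rightarrow> ('a, 'b) U_tensor" is "(-)"
  by (rule ideal_cong_diff)
lift_definition uminus_U_tensor :: "('a, 'b) U_tensor \<Rightarrow> ('a, 'b) U_tensor" is "uminus"
  by (rule ideal_cong_uminus)
lift_definition times_U_tensor :: "('a, 'b) U_tensor \<Rightarrow> ('a, 'b) U_tensor \<Rightarrow> ('a, 'b) U_tensor" is "(*)"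
  by (rule ideal_cong_mult)
instance
proof
  fix a b c :: "('a, 'b) U_tensor"
  note refl = equivp_reflp[OF equivp_ideal_cong]
  show "a + b + c = a + (b + c)" by transfer (simp add: add.assoc refl)
  show "a + b = b + a" by transfer (simp add: add.commute refl)
  show "0 + a = a" by transfer (simp add: refl)
  show "- a + a = 0" by transfer (simp add: refl)
  show "a - b = a + - b" by transfer (simp add: refl)
  show "a * b * c = a * (b * c)" by transfer (simp add: mult.assoc refl)
  show "(a + b) * c = a * c + b * c" by transfer (simp add: distrib_right refl)
  show "a * (b + c) = a * b + a * c" by transfer (simp add: distrib_left refl)
  show "1 * a = a" by transfer (simp add: refl)
  show "a * 1 = a" by transfer (simp add: refl)
  show "(0::('a, 'b) U_tensor) \<noteq> 1"
    by transfer (auto dest: algebra_extension_tensor_cong simp flip: single_one)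
qed
end

definition U_tensor_pure ::
    "('k::field, 'n::finite) U_plus \<Rightarrow> ('k, 'n) U_minus \<Rightarrow> ('k, 'n) U_tensor" where
  "U_tensor_pure a b = abs_U_tensor (Poly_Mapping.single (Pure_Tensor a b) 1)"

lift_definition U_tensor_scalar :: "'k::field \<Rightarrow> ('k, 'n::finite) U_tensor"
  is "Poly_Mapping.single 0" .

definition x_root :: "'n::finite \<Rightarrow> ('k::field, 'n) U_plus" where
  "x_root i = U_plus_incl (Abs_nil_plus (x_mat i))"

definition y_root :: "'n::finite \<Rightarrow> ('k::field, 'n) U_minus" where
  "y_root i = U_minus_incl (Abs_nil_minus (y_mat i))"

lemma root_vectors_mem:
  "Rep_nil_plus (Abs_nil_plus (x_mat i)) = (x_mat i :: ('k::field, 'n::finite) mat1)"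
  "Rep_nil_minus (Abs_nil_minus (y_mat i)) = (y_mat i :: ('k::field, 'n::finite) mat1)"
  by (rule Abs_nil_plus_inverse Abs_nil_minus_inverse;
      simp only: mem_Collect_eq nil_plus_iff nil_minus_iff;
      simp add: x_mat_def y_mat_def matrix_unit_def)+

definition xy_element :: "('k::field, 'n::finite) U_tensor" where
  "xy_element = (\<Sum>i\<in>UNIV. U_tensor_pure (x_root i) (y_root i))"

section \<open>Bidifferential operators on \<open>GL(n+1)/GL(n)\<times>GL(1)\<close>\<close>

text \<open>
  Functions on \<open>GL(n+1)/GL(n)\<times>GL(1)\<close> are the regular functions on \<open>GL(n+1)\<close> that are invariant
  under right translations by \<open>GL(1)\<times>GL(n)\<close>. A regular function is represented by a function on all
  matrices, of which only the values at invertible matrices matter.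
\<close>

inductive_set regular_functions :: "('k::field^'m^'m \<Rightarrow> 'k) set" where
  const: "(\<lambda>A. c) \<in> regular_functions"
| entry: "(\<lambda>A. A $ a $ b) \<in> regular_functions"
| inverse_det: "(\<lambda>A. inverse (det A)) \<in> regular_functions"
| add: "f \<in> regular_functions \<Longrightarrow> g \<in> regular_functions \<Longrightarrow> (\<lambda>A. f A + g A) \<in> regular_functions"
| mult: "f \<in> regular_functions \<Longrightarrow> g \<in> regular_functions \<Longrightarrow> (\<lambda>A. f A * g A) \<in> regular_functions"

definition levi_subgroup :: "('k::field, 'n::finite) mat1 set" where
  "levi_subgroup = {h. invertible h \<and> (\<forall>i. h $ None $ Some i = 0 \<and> h $ Some i $ None = 0)}"

definition homogeneous_functions :: "(('k::field, 'n::finite) mat1 \<Rightarrow> 'k) set" where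
  "homogeneous_functions =
     {f \<in> regular_functions. \<forall>A h. invertible A \<longrightarrow> h \<in> levi_subgroup \<longrightarrow> f (A ** h) = f A}"

text \<open>
  The left invariant vector field of \<open>X\<close>: the derivative of \<open>f (A exp (s X))\<close> at \<open>s = 0\<close>.
  It is only used for root vectors \<open>X\<close>, for which \<open>X\<^sup>2 = 0\<close>; hence \<open>exp (s X) = 1 + s X\<close> and
  \<open>f (A exp (s X))\<close> is a polynomial in \<open>s\<close> for every regular \<open>f\<close>.
\<close>

definition left_field ::
    "'k::field_char_0^'m^'m \<Rightarrow> ('k^'m^'m \<Rightarrow> 'k) \<Rightarrow> 'k^'m^'m \<Rightarrow> 'k" where
  "left_field X f A =
     poly (pderiv (THE p. \<forall>s. poly p s = f (A ** (mat 1 + map_matrix ((*) s) X)))) 0"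

lemma left_field_eqI:
  fixes X :: "'k::field_char_0^'m::finite^'m"
  assumes "\<And>s. poly p s = f (A ** (mat 1 + map_matrix ((*) s) X))"
  shows "left_field X f A = poly (pderiv p) 0"
proof -
  have "(THE p. \<forall>s. poly p s = f (A ** (mat 1 + map_matrix ((*) s) X))) = p"
    using assms by (intro the_equality) (auto simp flip: poly_eq_poly_eq_iff)
  then show ?thesis by (simp add: left_field_def)
qed

lemma det_unipotent:
  fixes a b :: "'m::finite"
  assumes "a \<noteq> b"
  shows "det (mat 1 + map_matrix ((*) s) (matrix_unit a b)) = (1 :: 'k::field)"
proof -
  have "mat 1 + map_matrix ((*) s) (matrix_unit a b) =
      (\<chi> k. if k = a then row a (mat 1) + s *s row b (mat 1) else row k (mat 1 :: 'k^'m^'m))"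
    by (auto simp: vec_eq_iff map_matrix_component matrix_unit_def mat_def row_def)
  then show ?thesis
    using det_row_operation[OF assms, where c = s and A = "mat 1 :: 'k^'m^'m"] by simp
qed

lemma entry_unipotent:
  fixes A :: "'k::field^'m::finite^'m"
  shows "(A ** (mat 1 + map_matrix ((*) s) (matrix_unit a b))) $ i $ j =
    A $ i $ j + s * (if j = b then A $ i $ a else 0)"
  by (simp add: matrix_add_ldistrib)
    (auto simp: matrix_matrix_mult_def map_matrix_component matrix_unit_def if_distrib sum.delta
      cong: if_cong)

lemma left_field_regular:
  fixes f :: "'k::field_char_0^'m::finite^'m \<Rightarrow> 'k"
  assumes "a \<noteq> b" "f \<in> regular_functions"
  shows "\<exists>p. \<forall>s. poly p s = f (A ** (mat 1 + map_matrix ((*) s) (matrix_unit a b)))"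
    and "left_field (matrix_unit a b) f \<in> regular_functions"
proof -
  let ?X = "matrix_unit a b :: 'k^'m^'m"
  let ?g = "\<lambda>(A :: 'k^'m^'m) s. A ** (mat 1 + map_matrix ((*) s) ?X)"
  have "(\<forall>A. \<exists>p. \<forall>s. poly p s = f (?g A s)) \<and> left_field ?X f \<in> regular_functions"
    using assms(2)
  proof induction
    case (const c)
    have p: "poly [:c:] s = c" for s :: 'k by simp
    then have "left_field ?X (\<lambda>A. c) = (\<lambda>A. 0)"
      using left_field_eqI[of "[:c:]" "\<lambda>A. c" _ ?X] by fastforce
    then show ?case using p regular_functions.const by metis
  next
    case (entry i j)
    let ?p = "\<lambda>A :: 'k^'m^'m. [:A $ i $ j, if j = b then A $ i $ a else 0:]"
    have p: "poly (?p A) s = ?g A s $ i $ j" for A s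
      by (simp add: entry_unipotent)
    have "left_field ?X (\<lambda>A. A $ i $ j) A = (if j = b then A $ i $ a else 0)" for A
      using left_field_eqI[of "?p A" "\<lambda>A. A $ i $ j" A ?X, OF p] by (simp add: pderiv_pCons)
    then have "left_field ?X (\<lambda>A. A $ i $ j) = (if j = b then (\<lambda>A. A $ i $ a) else (\<lambda>A. 0))"
      by auto
    then have "left_field ?X (\<lambda>A. A $ i $ j) \<in> regular_functions"
      by (auto intro: regular_functions.intros)
    then show ?case using p by blast
  next
    case inverse_det
    have p: "poly [:inverse (det A):] s = inverse (det (?g A s))" for A s
      by (simp add: det_mul det_unipotent[OF assms(1)])
    have "left_field ?X (\<lambda>A. inverse (det A)) A = 0" for A
      using left_field_eqI[of "[:inverse (det A):]" "\<lambda>A. inverse (det A)" A ?X, OF p] by simp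
    then have "left_field ?X (\<lambda>A. inverse (det A)) = (\<lambda>A. 0)" by auto
    then show ?case using p regular_functions.const by metis
  next
    case (add f h)
    then obtain p q where p: "\<And>A s. poly (p A) s = f (?g A s)" and q: "\<And>A s. poly (q A) s = h (?g A s)"
      by metis
    have pq: "poly (p A + q A) s = f (?g A s) + h (?g A s)" for A s by (simp add: p q)
    have "left_field ?X (\<lambda>A. f A + h A) = (\<lambda>A. left_field ?X f A + left_field ?X h A)"
      using left_field_eqI[of "p A + q A" "\<lambda>A. f A + h A" A ?X for A, OF pq]
        left_field_eqI[of "p A" f A ?X for A, OF p] left_field_eqI[of "q A" h A ?X for A, OF q]
      by (auto simp: pderiv_add)
    then show ?case using pq add by (metis regular_functions.add)
  next
    case (mult f h)
    then obtain p q where p: "\<And>A s. poly (p A) s = f (?g A s)" and q: "\<And>A s. poly (q A) s = h (?g A s)"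
      by metis
    have pq: "poly (p A * q A) s = f (?g A s) * h (?g A s)" for A s by (simp add: p q)
    have g0: "?g A 0 = A" for A
      by (simp add: vec_eq_iff entry_unipotent)
    have "left_field ?X (\<lambda>A. f A * h A) =
        (\<lambda>A. f A * left_field ?X h A + h A * left_field ?X f A)"
      using left_field_eqI[of "p A * q A" "\<lambda>A. f A * h A" A ?X for A, OF pq]
        left_field_eqI[of "p A" f A ?X for A, OF p] left_field_eqI[of "q A" h A ?X for A, OF q]
        p[of _ 0] q[of _ 0]
      by (auto simp: pderiv_mult g0)
    moreover have "(\<lambda>A. f A * left_field ?X h A + h A * left_field ?X f A) \<in> regular_functions"
      using mult by (intro regular_functions.add regular_functions.mult) auto
    ultimately show ?case using pq by metis
  qed
  then show "\<exists>p. \<forall>s. poly p s = f (?g A s)" and "left_field ?X f \<in> regular_functions" by auto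
qed

text \<open>
  \<open>xy_operator m\<close> is the bidifferential operator by which \<open>xy_element ^ m\<close> acts, i.e. the
  \<open>m\<close>-fold application of \<open>f \<otimes> g \<mapsto> (\<Sum>i. x\<^sub>i f \<otimes> y\<^sub>i g)\<close> followed by multiplication.
\<close>

primrec xy_operator :: "nat \<Rightarrow> (('k::field_char_0, 'n::finite) mat1 \<Rightarrow> 'k) \<Rightarrow>
    (('k, 'n) mat1 \<Rightarrow> 'k) \<Rightarrow> ('k, 'n) mat1 \<Rightarrow> 'k" where
  "xy_operator 0 f g A = f A * g A"
| "xy_operator (Suc m) f g A =
     (\<Sum>i\<in>UNIV. xy_operator m (left_field (x_mat i) f) (left_field (y_mat i) g) A)"

section \<open>The two formal power series\<close>

text \<open>
  The formal parameter \<open>t\<close> is \<open>fps_X\<close>. Both series are written for the values \<open>P m\<close> of the \<open>m\<close>-th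
  power of \<open>x \<otimes> y\<close> in a ring \<open>'b\<close> into which the scalars are embedded by \<open>\<iota>\<close>.
\<close>

definition fps_scalar :: "('k \<Rightarrow> 'b) \<Rightarrow> 'k fps \<Rightarrow> 'b fps" where
  "fps_scalar \<iota> f = Abs_fps (\<lambda>n. \<iota> (fps_nth f n))"

definition twist_term ::
    "('k::field_char_0 \<Rightarrow> 'b::ring_1) \<Rightarrow> (nat \<Rightarrow> 'b) \<Rightarrow> 'k fps \<Rightarrow> nat \<Rightarrow> 'b fps" where
  "twist_term \<iota> P lam m =
     fps_scalar \<iota> ((- fps_X) ^ m / (fact m * (\<Prod>j<m. lam - of_nat j * fps_X))) * fps_const (P m)"

definition bbew_term ::
    "('k::field_char_0 \<Rightarrow> 'b::ring_1) \<Rightarrow> (nat \<Rightarrow> 'b) \<Rightarrow> 'k \<Rightarrow> nat \<Rightarrow> 'b fps" where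
  "bbew_term \<iota> P \<mu> r =
     fps_scalar \<iota> ((- (fps_X / fps_const (2 * \<mu>))) ^ r) *
     (\<Sum>s=1..r. \<Sum>k=1..s. fps_const
        (\<iota> ((- 1) ^ (r - k) * of_nat k ^ (r - 1) / (fact s * fact (s - k) * fact (k - 1))) * P s))"

end

theory Submission
  imports Defs
begin

text \<open>
  With \<open>\<lambda> = c - t\<close> and \<open>c = 2\<mu>\<close> the \<open>m\<close>-th coefficient of the twist is
  \<open>1/m! \<Prod>\<^sub>j (-t)/(c - j t)\<close>, the product running over \<open>1 \<le> j \<le> m\<close>. By partial fractions its
  expansion in \<open>t\<close> has the coefficients \<open>(\<Sum>k\<le>m. (-1)\<^sup>k k\<^sup>n / (m! (m-k)! k!)) / c\<^sup>n\<close>, i.e.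
  \<open>(-1)\<^sup>m S(n,m) / (m! c\<^sup>n)\<close> with the Stirling numbers of the second kind \<open>S(n,m)\<close>; multiplying
  the sum by \<open>k - (m+1)\<close> termwise gives the recursion in \<open>m\<close> that proves this. Up to the
  cancellation \<open>k\<^sup>n / k! = k\<^sup>n\<^sup>-\<^sup>1 / (k-1)!\<close> these are the coefficients of the second operator.
\<close>

section \<open>Stirling numbers of the second kind, with sign and factorial\<close>

definition stirling_coeff :: "nat \<Rightarrow> nat \<Rightarrow> 'k::field_char_0" where
  "stirling_coeff m n = (\<Sum>k\<le>m. (- 1) ^ k * of_nat k ^ n / (fact m * fact (m - k) * fact k))"

lemma stirling_coeff_0_0 [simp]: "stirling_coeff 0 0 = 1"
  and stirling_coeff_0_Suc [simp]: "stirling_coeff 0 (Suc n) = 0"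
  by (simp_all add: stirling_coeff_def)

text \<open>At \<open>n = 0\<close> the sum is, up to a constant factor, the alternating sum of a
  row of Pascal's triangle.\<close>

lemma stirling_coeff_Suc_0 [simp]: "stirling_coeff (Suc m) 0 = (0 :: 'k::field_char_0)"
proof -
  have "stirling_coeff (Suc m) 0 =
      (\<Sum>k\<le>Suc m. (- 1) ^ k * of_nat (Suc m choose k)) / (fact (Suc m) * fact (Suc m) :: 'k)"
    unfolding stirling_coeff_def sum_divide_distrib
    by (intro sum.cong) (simp_all add: binomial_fact field_simps del: fact_Suc)
  then show ?thesis by (simp only: choose_alternating_sum[OF zero_less_Suc] div_0)
qed

lemma stirling_coeff_Suc_Suc:
  "of_nat (Suc m) * (stirling_coeff (Suc m) (Suc n) - of_nat (Suc m) * stirling_coeff (Suc m) n) =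
    - (stirling_coeff m n :: 'k::field_char_0)" (is "?l = ?r")
proof -
  have summand: "of_nat (Suc m) *
      ((- 1) ^ k * of_nat k ^ Suc n / (fact (Suc m) * fact (Suc m - k) * fact k)
        - of_nat (Suc m) * ((- 1) ^ k * of_nat k ^ n / (fact (Suc m) * fact (Suc m - k) * fact k)))
    = - ((- 1) ^ k * of_nat k ^ n / (fact m * fact (m - k) * fact k) :: 'k)" if "k \<le> m" for k
  proof -
    \<comment> \<open>Here \<open>M\<close> is \<open>m+1\<close> and \<open>D\<close> is
      \<open>m+1-k\<close>, so \<open>M - D\<close> is \<open>k\<close>; \<open>f\<close>,
      \<open>g\<close>, \<open>h\<close> are the factorials of \<open>m\<close>, \<open>m-k\<close>,
      \<open>k\<close>, and \<open>D * g\<close> is \<open>(m+1-k)!\<close>.\<close>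
    have cancel: "M * (u * (M - D) / (M * f * (D * g) * h) - M * (u / (M * f * (D * g) * h)))
      = - (u / (f * g * h))" if "M \<noteq> 0" "D \<noteq> 0" "f \<noteq> 0" "g \<noteq> 0" "h \<noteq> 0" for u f g h M D :: 'k
      using that by (simp add: field_simps)
    have k: "of_nat k = (of_nat (Suc m) - of_nat (Suc m - k) :: 'k)"
      using that by (simp add: of_nat_diff)
    have "of_nat (Suc m - k) \<noteq> (0 :: 'k)"
      using that by (simp del: of_nat_diff)
    from cancel[of "of_nat (Suc m)", OF _ this, of "fact m" "fact (m - k)" "fact k"
        "(- 1) ^ k * of_nat k ^ n", folded k]
    show ?thesis
      using that by (simp add: Suc_diff_le mult_ac del: of_nat_Suc of_nat_diff)
  qed
  have "?l = (\<Sum>k\<le>Suc m. of_nat (Suc m) *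
      ((- 1) ^ k * of_nat k ^ Suc n / (fact (Suc m) * fact (Suc m - k) * fact k)
        - of_nat (Suc m) * ((- 1) ^ k * of_nat k ^ n / (fact (Suc m) * fact (Suc m - k) * fact k))))"
    unfolding stirling_coeff_def sum_distrib_left sum_subtractf[symmetric] by (rule refl)
  \<comment> \<open>The summand at \<open>k = m+1\<close> drops out because its factor
    \<open>k - (m+1)\<close> is zero.\<close>
  also have "\<dots> = (\<Sum>k\<le>m. - ((- 1) ^ k * of_nat k ^ n / (fact m * fact (m - k) * fact k)))"
    unfolding sum.atMost_Suc using summand by (simp add: mult_ac del: of_nat_Suc fact_Suc)
  finally show ?thesis by (simp add: stirling_coeff_def sum_negf)
qed

text \<open>The recursion preserves vanishing above the diagonal. This leaves only finitely many
  twist terms in each degree of t.\<close>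

lemma stirling_coeff_eq_0:
  "n < m \<Longrightarrow> stirling_coeff m n = (0 :: 'k::field_char_0)"
proof (induction n arbitrary: m)
  case 0
  then show ?case by (cases m) simp_all
next
  case (Suc n)
  then obtain m' where m: "m = Suc m'" "n < m'" by (cases m) auto
  then show ?case
    using stirling_coeff_Suc_Suc[of m' n, where ?'k = 'k] Suc.IH[of m'] Suc.IH[of m]
    by (simp del: of_nat_Suc)
qed

section \<open>Expansion of the twist coefficients in powers of t\<close>

text \<open>The claimed series is verified by multiplying it with the denominator, one linear factor
  at a time; each step is the Stirling recursion read coefficientwise.\<close>

lemma twist_coefficient:
  fixes c :: "'k::field_char_0"
  assumes "c \<noteq> 0"
  shows "(- fps_X) ^ m / (fact m * (\<Prod>j<m. fps_const c - fps_X - of_nat j * fps_X)) =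
    Abs_fps (\<lambda>n. stirling_coeff m n / c ^ n)"
proof -
  let ?T = "\<lambda>m. Abs_fps (\<lambda>n. stirling_coeff m n / c ^ n)"
  let ?D = "\<lambda>m. fact m * (\<Prod>j<m. fps_const c - fps_X - of_nat j * fps_X) :: 'k fps"
  \<comment> \<open>The new factor, at \<open>j = m\<close>, is
    \<open>c - X - m X = c - (m+1) X\<close>: this is the shift caused by
    \<open>lam = c - X\<close>.\<close>
  have step: "?T (Suc m) * (of_nat (Suc m) * (fps_const c - of_nat (Suc m) * fps_X)) =
      - fps_X * ?T m" for m
  proof (rule fps_ext)
    fix n
    have "?T (Suc m) * (of_nat (Suc m) * (fps_const c - of_nat (Suc m) * fps_X)) =
        fps_const (of_nat (Suc m) * c) * ?T (Suc m)
        - fps_const (of_nat (Suc m) * of_nat (Suc m)) * (fps_X * ?T (Suc m))"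
      unfolding fps_of_nat[symmetric] fps_const_mult[symmetric] by (simp only: algebra_simps)
    then have "fps_nth (?T (Suc m) * (of_nat (Suc m) * (fps_const c - of_nat (Suc m) * fps_X))) n =
        of_nat (Suc m) * c * fps_nth (?T (Suc m)) n
        - of_nat (Suc m) * of_nat (Suc m) * fps_nth (fps_X * ?T (Suc m)) n"
      by (simp only: fps_sub_nth fps_mult_left_const_nth)
    \<comment> \<open>In degree 0 both sides vanish by \<open>stirling_coeff_Suc_0\<close>; positive
      degrees use the recursion.\<close>
    also have "\<dots> = fps_nth (- fps_X * ?T m) n"
    proof (cases n)
      case (Suc l)
      have "of_nat (Suc m) * c * (stirling_coeff (Suc m) (Suc l) / c ^ Suc l)
          - of_nat (Suc m) * of_nat (Suc m) * (stirling_coeff (Suc m) l / c ^ l) =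
        of_nat (Suc m) * (stirling_coeff (Suc m) (Suc l) - of_nat (Suc m) * stirling_coeff (Suc m) l)
          / c ^ l"
        using assms by (simp add: field_simps del: of_nat_Suc)
      then show ?thesis
        unfolding stirling_coeff_Suc_Suc using Suc by (simp del: of_nat_Suc)
    qed simp
    finally show "fps_nth (?T (Suc m) * (of_nat (Suc m) * (fps_const c - of_nat (Suc m) * fps_X))) n =
        fps_nth (- fps_X * ?T m) n" .
  qed
  have "?T m * ?D m = (- fps_X) ^ m"
  proof (induction m)
    case 0
    have "?T 0 = 1" by (rule fps_ext) (case_tac n; simp)
    then show ?case by simp
  next
    case (Suc m)
    have "?T (Suc m) * ?D (Suc m) =
        (?T (Suc m) * (of_nat (Suc m) * (fps_const c - of_nat (Suc m) * fps_X))) * ?D m"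
      by (simp add: algebra_simps)
    also have "\<dots> = - fps_X * (?T m * ?D m)"
      by (simp only: step mult.assoc)
    finally show ?case by (simp only: Suc power_Suc)
  qed
  \<comment> \<open>The constant term is \<open>fact m * c ^ m\<close>, so the denominator is
    nonzero and can be cancelled.\<close>
  moreover have "fps_nth (?D m) 0 \<noteq> 0"
  proof -
    have "(fact m :: 'k fps) = fps_const (fact m)"
      by (metis fps_of_nat of_nat_fact)
    moreover have "fps_nth (\<Prod>j<m. fps_const c - fps_X - of_nat j * fps_X) 0 = c ^ m"
      by (induction m) simp_all
    ultimately show ?thesis using assms by simp
  qed
  then have "?D m \<noteq> 0" by (metis fps_zero_nth)
  ultimately show ?thesis by (metis nonzero_mult_div_cancel_right)
qed

section \<open>Convergence of series of formal power series\<close>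

text \<open>Convergence is coefficientwise, and the \<open>n\<close>-th coefficient of the partial
  sums is constant from \<open>N = n+1\<close> on.\<close>

lemma fps_sums_triangular:
  fixes f :: "nat \<Rightarrow> 'b::ring_1 fps"
  assumes "\<And>m n. n < m \<Longrightarrow> fps_nth (f m) n = 0"
  shows "f sums Abs_fps (\<lambda>n. \<Sum>m\<le>n. fps_nth (f m) n)"
  unfolding sums_def
proof (rule tendsto_fpsI)
  fix n
  have "fps_nth (\<Sum>m<N. f m) n = (\<Sum>m\<le>n. fps_nth (f m) n)" if "N > n" for N
    unfolding fps_sum_nth using that assms by (intro sum.mono_neutral_right) auto
  then show "\<forall>\<^sub>F N in sequentially. fps_nth (\<Sum>m<N. f m) n = fps_nth (Abs_fps (\<lambda>n. \<Sum>m\<le>n. fps_nth (f m) n)) n"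
    by (auto intro: eventually_mono[OF eventually_gt_at_top[of n]])
qed

text \<open>Lets one argument serve both scalar embeddings, \<open>U_tensor_scalar\<close> and
  \<open>id\<close>.\<close>

locale unital_ring_hom =
  fixes \<iota> :: "'a::ring_1 \<Rightarrow> 'b::ring_1"
  assumes hom_add: "\<iota> (a + b) = \<iota> a + \<iota> b"
    and hom_mult: "\<iota> (a * b) = \<iota> a * \<iota> b"
    and hom_one: "\<iota> 1 = 1"
begin

lemma hom_zero: "\<iota> 0 = 0"
  using hom_add[of 0 0] by simp

lemma hom_sum: "\<iota> (sum f A) = (\<Sum>x\<in>A. \<iota> (f x))"
  by (induction A rule: infinite_finite_induct) (simp_all add: hom_zero hom_add)

end

section \<open>Comparison of the coefficients of the two series\<close>

lemma twist_term_nth: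
  assumes "\<mu> \<noteq> 0"
  shows "fps_nth (twist_term \<iota> P (fps_const (2 * \<mu>) - fps_X) m) n =
    \<iota> (stirling_coeff m n / (2 * \<mu>) ^ n) * P m"
  using assms by (simp add: twist_term_def twist_coefficient fps_scalar_def)

text \<open>The signs combine to \<open>(-1)^k\<close>, and extending
  \<open>k^(n-1) / (k-1)!\<close> by \<open>k\<close> gives the summands of
  \<open>stirling_coeff\<close>.\<close>

lemma bbew_coefficient:
  fixes c :: "'k::field_char_0"
  assumes "n \<ge> 1" "s \<le> n"
  shows "(- inverse c) ^ n * (\<Sum>k=1..s. (- 1) ^ (n - k) * of_nat k ^ (n - 1) /
      (fact s * fact (s - k) * fact (k - 1))) = stirling_coeff s n / c ^ n"
proof -
  have "(- inverse c) ^ n * ((- 1) ^ (n - k) * of_nat k ^ (n - 1) /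
      (fact s * fact (s - k) * fact (k - 1))) =
    (- 1) ^ k * of_nat k ^ n / (fact s * fact (s - k) * fact k) / c ^ n"
    if k: "k \<in> {1..s}" for k
  proof -
    obtain l where l: "k = Suc l" using k by (cases k) auto
    \<comment> \<open>From \<open>k \<le> s \<le> n\<close> the exponent \<open>n - k\<close> is a
      genuine difference \<open>d\<close>.\<close>
    obtain d where d: "n = k + d" using k assms(2) by (metis atLeastAtMost_iff le_iff_add order_trans)
    have sign: "(- inverse c) ^ n * (- 1) ^ (n - k) = (- 1) ^ k / c ^ n"
    proof -
      have "(- inverse c) ^ n = (- 1) ^ k * (- 1) ^ d / c ^ n"
        using power_minus[of "inverse c" n] by (simp add: d power_add power_inverse divide_inverse)
      moreover have "(- 1 :: 'k) ^ d * (- 1) ^ d = 1"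
        by (simp flip: power_mult_distrib)
      ultimately show ?thesis by (simp add: d mult.assoc)
    qed
    have frac: "of_nat k ^ (n - 1) / fact (k - 1) = (of_nat k ^ n / fact k :: 'k)"
      using l d by (simp add: fact_Suc del: of_nat_Suc)
    have "u * (v * w / (f * g * h)) = u * v * (w / h) / (f * g)" for u v w f g h :: 'k
      by (simp add: mult_ac)
    then show ?thesis
      by (simp only: sign frac) (simp add: mult_ac)
  qed
  then have "(- inverse c) ^ n * (\<Sum>k=1..s. (- 1) ^ (n - k) * of_nat k ^ (n - 1) /
      (fact s * fact (s - k) * fact (k - 1))) =
    (\<Sum>k=1..s. (- 1) ^ k * of_nat k ^ n / (fact s * fact (s - k) * fact k)) / c ^ n"
    unfolding sum_distrib_left sum_divide_distrib by (intro sum.cong refl) simp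
  \<comment> \<open>The summand at \<open>k = 0\<close> may be added, since \<open>0 ^ n = 0\<close>
    for \<open>n \<ge> 1\<close>.\<close>
  also have "(\<Sum>k=1..s. (- 1) ^ k * of_nat k ^ n / (fact s * fact (s - k) * fact k)) =
      (stirling_coeff s n :: 'k)"
    unfolding stirling_coeff_def using assms
    by (intro sum.mono_neutral_left) (auto simp: not_less_eq_eq)
  finally show ?thesis .
qed

text \<open>The double sum is constant in t, so the whole term is a monomial of degree
  \<open>r\<close>.\<close>

lemma bbew_term_nth:
  fixes \<iota> :: "'k::field_char_0 \<Rightarrow> 'b::ring_1"
  assumes "unital_ring_hom \<iota>" "r \<ge> 1"
  shows "fps_nth (bbew_term \<iota> P \<mu> r) n =
    (if n = r then \<Sum>s=1..r. \<iota> (stirling_coeff s r / (2 * \<mu>) ^ r) * P s else 0)"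
proof -
  interpret unital_ring_hom \<iota> by fact
  let ?q = "\<lambda>s k. (- 1) ^ (r - k) * of_nat k ^ (r - 1) / (fact s * fact (s - k) * fact (k - 1)) :: 'k"
  let ?a = "(- inverse (2 * \<mu>)) ^ r"
  have "- (fps_X / fps_const (2 * \<mu>)) = fps_const (- inverse (2 * \<mu>)) * fps_X"
    by (rule fps_ext) (simp add: fps_divide_def fps_const_inverse)
  then have scal: "fps_scalar \<iota> ((- (fps_X / fps_const (2 * \<mu>))) ^ r) = fps_const (\<iota> ?a) * fps_X ^ r"
    by (intro fps_ext)
      (simp only: power_mult_distrib fps_const_power, simp add: fps_scalar_def hom_zero)
  have const: "(\<Sum>s=1..r. \<Sum>k=1..s. fps_const (\<iota> (?q s k) * P s)) =
      fps_const (\<Sum>s=1..r. \<Sum>k=1..s. \<iota> (?q s k) * P s)"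
    by (rule fps_ext) (simp add: fps_sum_nth)
  have "\<iota> ?a * (\<Sum>s=1..r. \<Sum>k=1..s. \<iota> (?q s k) * P s) =
      (\<Sum>s=1..r. \<iota> (?a * (\<Sum>k=1..s. ?q s k)) * P s)"
    by (simp only: hom_mult hom_sum sum_distrib_left sum_distrib_right mult.assoc)
  also have "\<dots> = (\<Sum>s=1..r. \<iota> (stirling_coeff s r / (2 * \<mu>) ^ r) * P s)"
    using assms(2) by (intro sum.cong refl) (simp only: bbew_coefficient atLeastAtMost_iff)
  finally show ?thesis
    unfolding bbew_term_def scal const by simp
qed

text \<open>The twist is summed over powers of \<open>x \<otimes> y\<close>, the other series over
  powers of t; in each degree both reduce to the same finite sum. \<open>P\<close> stays arbitrary
  to cover algebra elements and operator values alike.\<close>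

lemma twist_eq_bbew:
  fixes \<iota> :: "'k::field_char_0 \<Rightarrow> 'b::ring_1" and P :: "nat \<Rightarrow> 'b"
  assumes "unital_ring_hom \<iota>" "\<mu> \<noteq> 0"
  defines "T \<equiv> twist_term \<iota> P (fps_const (2 * \<mu>) - fps_X)"
    and "B \<equiv> \<lambda>r. bbew_term \<iota> P \<mu> (Suc r)"
  shows "summable T" "summable B" "suminf T = fps_const (P 0) + suminf B"
proof -
  interpret unital_ring_hom \<iota> by fact
  have Tn: "fps_nth (T m) n = \<iota> (stirling_coeff m n / (2 * \<mu>) ^ n) * P m" for m n
    unfolding T_def using assms(2) by (rule twist_term_nth)
  have Bn: "fps_nth (B r) n = (if n = Suc r
      then \<Sum>s=1..n. \<iota> (stirling_coeff s n / (2 * \<mu>) ^ n) * P s else 0)" for r n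
    unfolding B_def by (simp add: bbew_term_nth[OF assms(1)])
  have T: "T sums Abs_fps (\<lambda>n. \<Sum>m\<le>n. fps_nth (T m) n)"
    by (rule fps_sums_triangular) (simp add: Tn stirling_coeff_eq_0 hom_zero)
  have B: "B sums Abs_fps (\<lambda>n. \<Sum>r\<le>n. fps_nth (B r) n)"
    by (rule fps_sums_triangular) (simp add: Bn)
  show "summable T" "summable B" using T B by (auto simp: sums_iff)
  have "(\<Sum>m\<le>n. fps_nth (T m) n) = fps_nth (fps_const (P 0)) n + (\<Sum>r\<le>n. fps_nth (B r) n)" for n
  proof (cases n)
    case 0
    then show ?thesis by (simp add: Tn Bn hom_one)
  next
    case (Suc l)
    \<comment> \<open>For \<open>n \<ge> 1\<close> the term \<open>m = 0\<close> vanishes; on the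
      other side only \<open>r = n - 1\<close> contributes.\<close>
    have "(\<Sum>m\<le>n. fps_nth (T m) n) = (\<Sum>m=1..n. fps_nth (T m) n)"
      using Suc by (intro sum.mono_neutral_right) (auto simp: Tn hom_zero not_less_eq_eq)
    also have "\<dots> = (\<Sum>r\<le>n. fps_nth (B r) n)"
      by (simp add: Tn Bn Suc)
    finally show ?thesis using Suc by simp
  qed
  then show "suminf T = fps_const (P 0) + suminf B"
    using T B by (auto simp: sums_iff fps_eq_iff)
qed

lemma unital_ring_hom_U_tensor_scalar:
  "unital_ring_hom (U_tensor_scalar :: 'k::field \<Rightarrow> ('k, 'n::finite) U_tensor)"
proof
  note refl = equivp_reflp[OF equivp_ideal_cong]
  fix a b :: 'k
  show "U_tensor_scalar (a + b) = (U_tensor_scalar a + U_tensor_scalar b :: ('k, 'n) U_tensor)"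
    by transfer (simp add: single_add refl)
  show "U_tensor_scalar (a * b) = (U_tensor_scalar a * U_tensor_scalar b :: ('k, 'n) U_tensor)"
    by transfer (simp add: mult_single refl)
  show "U_tensor_scalar 1 = (1 :: ('k, 'n) U_tensor)"
    by transfer (simp add: single_one refl)
qed

lemma unital_ring_hom_id: "unital_ring_hom id"
  by standard simp_all

theorem proposition7p1:
  fixes \<mu> :: "'k::field_char_0" and lam :: "'k fps"
  assumes "\<mu> \<noteq> 0" and "lam = fps_const (2 * \<mu>) - fps_X"
  shows
    "(let P = (\<lambda>m. (xy_element :: ('k, 'n::finite) U_tensor) ^ m) in
        summable (twist_term U_tensor_scalar P lam) \<and>
        summable (\<lambda>r. bbew_term U_tensor_scalar P \<mu> (Suc r)) \<and>
        suminf (twist_term U_tensor_scalar P lam) =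
          1 + suminf (\<lambda>r. bbew_term U_tensor_scalar P \<mu> (Suc r)))
     \<and>
     (\<forall>f \<in> homogeneous_functions. \<forall>g \<in> homogeneous_functions.
      \<forall>A :: ('k, 'n) mat1. invertible A \<longrightarrow>
        (let P = (\<lambda>m. xy_operator m f g A) in
         summable (twist_term id P lam) \<and>
         summable (\<lambda>r. bbew_term id P \<mu> (Suc r)) \<and>
         suminf (twist_term id P lam) =
           fps_const (f A * g A) + suminf (\<lambda>r. bbew_term id P \<mu> (Suc r))))"
proof -
  \<comment> \<open>The constant \<open>P 0\<close> is \<open>1\<close> for the powers of
    \<open>xy_element\<close> and \<open>f A * g A\<close> for the operators, which are evaluated
    pointwise at \<open>A\<close>.\<close>
  note tensor = twist_eq_bbew[OF unital_ring_hom_U_tensor_scalar assms(1),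
      where P = "\<lambda>m. (xy_element :: ('k, 'n) U_tensor) ^ m"]
  note operator = twist_eq_bbew[OF unital_ring_hom_id assms(1)]
  show ?thesis
    unfolding Let_def assms(2)
    using tensor operator[where P = "\<lambda>m. xy_operator m f g A" for f g and A :: "('k, 'n) mat1"]
    by simp
qed

end
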